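(* Let $F\subseteq\mathbb{R}^d$ be non-empty and bounded. For any dimension function $\phi$ there exists a dimension function $\Psi$ satisfying $\Psi(R)\le\phi(R)$ for all sufficiently small $R>0$ such that $$\dim_{\mathrm L}^{\Psi}F=\underline{\dim}_{\mathrm L}^{\Psi}F=\dim_{\mathrm L}F.$$
   Context: $B(x,R)$ is the ball of centre $x$ and radius $R$, and $N_r(E)$ is the smallest number of balls of radius $r$ needed to cover $E$. A dimension function is a function $\phi:(0,1)\to(0,\infty)$ such that $\phi(R)$ decreases as $R\to0$, and $\phi(R)\log(1/R)$ increases to infinity as $R$ decreases to $0$ (monotonicity in the non-strict sense, so constant functions are allowed). The lower Assouad dimension of $F$ is $$\dim_{\mathrm L}F=\sup\Big\{s\ge0:\ \exists\,C>0 \text{ such that } \forall\, 0<r<R<1,\ \forall x\in F,\ N_r(B(x,R)\cap F)\ge C\,(R/r)^{s}\Big\}.$$ The $\phi$-lower dimension of $F$ is $$\dim_{\mathrm L}^{\phi}F=\sup\Big\{s\ge0:\ \exists\,C>0 \text{ such that } \forall\, 0<R<1,\ \inf_{x\in F}N_{R^{1+\phi(R)}}(B(x,R)\cap F)\ge C\,R^{-\phi(R)s}\Big\}.$$ The quasi $\phi$-lower dimension of $F$ is $$\underline{\dim}_{\mathrm L}^{\phi}F=\sup\Big\{s\ge0:\ \exists\,C>0 \text{ such that } \forall\, 0<r\le R^{1+\phi(R)}<R<1,\ \inf_{x\in F}N_{r}(B(x,R)\cap F)\ge C\,(R/r)^{s}\Big\}.$$ *)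

theory Defs
  imports "HOL-Analysis.Analysis"
begin

text \<open>
  Balls are open, both for localising the set and for covering; the centres of the covering
  balls are arbitrary points of the ambient space. The value is unspecified when no finite
  cover exists, which cannot happen for a bounded subset of Euclidean space.
\<close>
definition covering_number :: "real \<Rightarrow> 'a::metric_space set \<Rightarrow> nat" where
  "covering_number r E =
     (LEAST n. \<exists>A. finite A \<and> card A = n \<and> E \<subseteq> (\<Union>c\<in>A. ball c r))"

lemma covering_number_attained:
  fixes E :: "'a::euclidean_space set"
  assumes "bounded E" and "r > 0"
  shows "\<exists>A. finite A \<and> card A = covering_number r E \<and> E \<subseteq> (\<Union>c\<in>A. ball c r)"
proof -
  have "compact (closure E)"
    using assms(1) by simp
  moreover have "closure E \<subseteq> (\<Union>x\<in>closure E. ball x r)"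
    using assms(2) by auto
  ultimately obtain A where "finite A" "closure E \<subseteq> (\<Union>x\<in>A. ball x r)"
    by (metis compactE_image open_ball)
  then have "\<exists>n A. finite A \<and> card A = n \<and> E \<subseteq> (\<Union>c\<in>A. ball c r)"
    using closure_subset by blast
  then show ?thesis
    unfolding covering_number_def by (rule LeastI_ex)
qed

text \<open>Only the values on the open interval from 0 to 1 matter.\<close>
definition dimension_function :: "(real \<Rightarrow> real) \<Rightarrow> bool" where
  "dimension_function \<phi> \<longleftrightarrow>
     (\<forall>R\<in>{0<..<1}. 0 < \<phi> R) \<and>
     mono_on {0<..<1} \<phi> \<and>
     monotone_on {0<..<1} (\<le>) (\<ge>) (\<lambda>R. \<phi> R * ln (1 / R)) \<and>
     filterlim (\<lambda>R. \<phi> R * ln (1 / R)) at_top (at_right 0)"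

text \<open>The suprema are taken in the extended reals, so that they are always meaningful.\<close>

definition lower_dim :: "'a::metric_space set \<Rightarrow> ereal" where
  "lower_dim F = Sup (ereal ` {s. 0 \<le> s \<and> (\<exists>C>0. \<forall>r R. 0 < r \<and> r < R \<and> R < 1 \<longrightarrow>
     (\<forall>x\<in>F. real (covering_number r (ball x R \<inter> F)) \<ge> C * (R / r) powr s))})"

definition phi_lower_dim :: "(real \<Rightarrow> real) \<Rightarrow> 'a::metric_space set \<Rightarrow> ereal" where
  "phi_lower_dim \<phi> F = Sup (ereal ` {s. 0 \<le> s \<and> (\<exists>C>0. \<forall>R. 0 < R \<and> R < 1 \<longrightarrow>
     (INF x\<in>F. real (covering_number (R powr (1 + \<phi> R)) (ball x R \<inter> F)))
       \<ge> C * R powr (- \<phi> R * s))})"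

definition quasi_phi_lower_dim :: "(real \<Rightarrow> real) \<Rightarrow> 'a::metric_space set \<Rightarrow> ereal" where
  "quasi_phi_lower_dim \<phi> F = Sup (ereal ` {s. 0 \<le> s \<and> (\<exists>C>0. \<forall>r R.
     0 < r \<and> r \<le> R powr (1 + \<phi> R) \<and> R powr (1 + \<phi> R) < R \<and> R < 1 \<longrightarrow>
     (INF x\<in>F. real (covering_number r (ball x R \<inter> F))) \<ge> C * (R / r) powr s)})"

end

theory Submission
  imports Defs "HOL-Real_Asymp.Real_Asymp"
begin

text \<open>
  Every \<open>s\<close> admissible for the lower dimension is admissible for the quasi \<open>\<Psi>\<close>-lower
  dimension, and every \<open>s\<close> admissible for the latter is admissible for the \<open>\<Psi>\<close>-lower
  dimension, whatever \<open>\<Psi>\<close> is. So everything rests on choosing \<open>\<Psi>\<close> with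
  \<open>phi_lower_dim \<Psi> F \<le> lower_dim F\<close>.

  The lower dimension is already detected by pairs of scales with any prescribed ratio. Suppose
  that at one ratio \<open>K\<close> every sufficiently small ball contains about \<open>K powr s\<close> separated points
  of \<open>F\<close>. Iterating this inside the balls around these points bounds covering numbers from
  below at all ratios, so \<open>s\<close> is admissible. Hence, if \<open>s\<close> exceeds the lower dimension, then for
  every \<open>K\<close> there are arbitrarily small balls that are thin at ratio \<open>K\<close>: they can be covered by
  fewer than \<open>(8 * K) powr s\<close> balls whose radius is smaller by the factor \<open>K\<close>
  (\<open>thin_ball_at_given_ratio\<close>).

  This leaves the ratios at our disposal. Let \<open>L\<close> be the lower dimension, \<open>k n = n + 1\<close>, and pick
  thin balls of radius \<open>\<rho> n\<close> at ratio \<open>exp (k n)\<close> for the exponent \<open>L + 1 / k n\<close>. If the \<open>\<rho> n\<close>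
  decrease fast enough, then some dimension function \<open>\<Psi> \<le> \<phi>\<close> satisfies
  \<open>\<Psi> (\<rho> n) * ln (1 / \<rho> n) = k n\<close>, which says exactly that \<open>\<Psi>\<close> compares the scale \<open>\<rho> n\<close> with
  the scale \<open>\<rho> n / exp (k n)\<close> (\<open>dimension_function_through_points\<close>). The thin balls then rule
  out every exponent \<open>u > L\<close> for the \<open>\<Psi>\<close>-lower dimension: admissibility of \<open>u\<close> would bound
  \<open>exp (k n * (u - L))\<close> uniformly in \<open>n\<close>.
\<close>

section \<open>Covering numbers and separated sets\<close>

text \<open>
  An open ball of radius \<open>r\<close> contains at most one point of a \<open>2 * r\<close>-separated set, so the
  points inject into the centres of any cover.
\<close>
lemma card_separated_le_covering_number:
  fixes E :: "'a::euclidean_space set"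
  assumes "bounded E" and "r > 0" and "finite Y" and "Y \<subseteq> E"
    and sep: "pairwise (\<lambda>x y. 2 * r \<le> dist x y) Y"
  shows "card Y \<le> covering_number r E"
proof -
  obtain A where A: "finite A" "card A = covering_number r E" "E \<subseteq> (\<Union>c\<in>A. ball c r)"
    using covering_number_attained[OF assms(1,2)] by blast
  have "\<forall>y\<in>Y. \<exists>c\<in>A. dist c y < r"
    using A(3) assms(4) by fastforce
  then obtain f where f: "\<forall>y\<in>Y. f y \<in> A \<and> dist (f y) y < r"
    by metis
  have "inj_on f Y"
  proof (rule inj_onI)
    fix x y assume xy: "x \<in> Y" "y \<in> Y" "f x = f y"
    have "dist x y < 2 * r"
      using f xy dist_triangle3[of x y "f x"] by (smt (verit))
    then show "x = y"
      using sep xy unfolding pairwise_def by fastforce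
  qed
  then have "card Y \<le> card A"
    using f A(1) by (intro card_inj_on_le[of f]) auto
  then show ?thesis using A(2) by simp
qed

text \<open>
  Separated subsets have bounded size, so there is one with the most points; by maximality the
  balls around its points cover \<open>E\<close>.
\<close>
lemma separated_subset_of_covering_number:
  fixes E :: "'a::euclidean_space set"
  assumes "bounded E" and "\<delta> > 0"
  obtains Y where "finite Y" "Y \<subseteq> E" "pairwise (\<lambda>x y. \<delta> \<le> dist x y) Y"
    "covering_number \<delta> E \<le> card Y"
proof -
  define P where "P Y \<longleftrightarrow> finite Y \<and> Y \<subseteq> E \<and> pairwise (\<lambda>x y. \<delta> \<le> dist x y) Y" for Y
  have bound: "card Y < Suc (covering_number (\<delta> / 2) E)" if "P Y" for Y
    using card_separated_le_covering_number[of E "\<delta> / 2" Y] assms that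
    by (simp add: P_def less_Suc_eq_le)
  have "P {}" by (simp add: P_def)
  then obtain Y where Y: "P Y" and max: "\<forall>Z. P Z \<longrightarrow> card Z \<le> card Y"
    using ex_has_greatest_nat[of P "{}" card] bound by (metis less_imp_le)
  have "E \<subseteq> (\<Union>c\<in>Y. ball c \<delta>)"
  proof (rule ccontr)
    assume "\<not> ?thesis"
    then obtain x where x: "x \<in> E" "\<forall>c\<in>Y. \<delta> \<le> dist c x"
      by (force simp: not_less)
    then have "P (insert x Y)"
      using Y by (simp add: P_def pairwise_insert dist_commute)
    moreover have "x \<notin> Y" using x(2) assms(2) by force
    ultimately show False
      using max Y by (force simp: P_def)
  qed
  then have "covering_number \<delta> E \<le> card Y"
    unfolding covering_number_def using Y
    by (intro Least_le) (auto simp: P_def)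
  then show ?thesis using that Y by (auto simp: P_def)
qed

lemma one_le_covering_number:
  fixes E :: "'a::euclidean_space set"
  assumes "bounded E" and "r > 0" and "x \<in> E"
  shows "1 \<le> covering_number r E"
  using card_separated_le_covering_number[of E r "{x}"] assms by simp

section \<open>Exponents of the lower dimension from a single ratio of scales\<close>

text \<open>
  Many points at ratio \<open>K\<close> reproduce themselves. Inside the ball of radius \<open>R / 2\<close> there are
  at least \<open>M\<close> points at mutual distance \<open>R / (2 * K)\<close>, and the construction repeats in the
  balls of radius \<open>R / (8 * K)\<close> around them. Halving \<open>R\<close> keeps these smaller balls inside the
  original one, and the further factor \<open>4\<close> keeps them far apart; hence one step costs
  a factor \<open>8 * K\<close> in scale.
\<close>
lemma iterated_separated_set:
  fixes F :: "'a::euclidean_space set"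
  assumes "bounded F" and "K \<ge> 1" and "M \<ge> 0"
    and many: "\<And>R x. 0 < R \<Longrightarrow> R < \<rho> \<Longrightarrow> x \<in> F \<Longrightarrow>
      M \<le> real (covering_number (R / K) (ball x R \<inter> F))"
    and "0 < R" and "R < \<rho>" and "x \<in> F"
  shows "\<exists>Y. finite Y \<and> Y \<subseteq> ball x R \<inter> F \<and>
    pairwise (\<lambda>y z. 2 * (R / (8 * K) ^ m) \<le> dist y z) Y \<and> M ^ m \<le> real (card Y)"
  using assms(5-7)
proof (induction m arbitrary: R x)
  case 0
  then show ?case by (intro exI[of _ "{x}"]) auto
next
  case (Suc m)
  define R' where "R' = R / (8 * K)"
  have "R' \<le> R / (8 * 1)"
    unfolding R'_def using Suc.prems \<open>K \<ge> 1\<close> by (intro divide_left_mono mult_left_mono) auto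
  then have R': "0 < R'" "R' < \<rho>" "R' \<le> R / 8" "4 * R' = R / 2 / K"
    using Suc.prems \<open>K \<ge> 1\<close> by (auto simp: R'_def)
  have "0 < 4 * R'" "bounded (ball x (R / 2) \<inter> F)"
    using R' by (auto intro: bounded_Int)
  then obtain Y where Y: "finite Y" "Y \<subseteq> ball x (R / 2) \<inter> F"
      "pairwise (\<lambda>y z. 4 * R' \<le> dist y z) Y"
      "covering_number (4 * R') (ball x (R / 2) \<inter> F) \<le> card Y"
    by (metis separated_subset_of_covering_number)
  have MY: "M \<le> real (card Y)"
    using many[of "R / 2" x] Suc.prems Y(4) R'(4) by simp
  have "\<forall>y\<in>Y. \<exists>Z. finite Z \<and> Z \<subseteq> ball y R' \<inter> F \<and>
      pairwise (\<lambda>y z. 2 * (R' / (8 * K) ^ m) \<le> dist y z) Z \<and> M ^ m \<le> real (card Z)"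
    using Suc.IH R' Y(2) by blast
  then obtain Z where Z: "\<And>y. y \<in> Y \<Longrightarrow> finite (Z y)" "\<And>y. y \<in> Y \<Longrightarrow> Z y \<subseteq> ball y R' \<inter> F"
      "\<And>y. y \<in> Y \<Longrightarrow> pairwise (\<lambda>y z. 2 * (R' / (8 * K) ^ m) \<le> dist y z) (Z y)"
      "\<And>y. y \<in> Y \<Longrightarrow> M ^ m \<le> real (card (Z y))"
    by metis
  have apart: "2 * R' \<le> dist u v"
    if "y \<in> Y" "z \<in> Y" "y \<noteq> z" "u \<in> Z y" "v \<in> Z z" for y z u v
  proof -
    have "dist y u < R'" "dist z v < R'"
      using Z(2)[OF that(1)] Z(2)[OF that(2)] that(4,5) by auto
    moreover have "4 * R' \<le> dist y z"
      using Y(3) that by (auto simp: pairwise_def)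
    ultimately show ?thesis
      using dist_triangle[of y z u] dist_triangle[of u z v] by (simp add: dist_commute)
  qed
  have pow: "R / (8 * K) ^ Suc m = R' / (8 * K) ^ m" by (simp add: R'_def)
  have "1 \<le> (8 * K) ^ m"
    using \<open>K \<ge> 1\<close> by (intro one_le_power) auto
  then have "R' / (8 * K) ^ m \<le> R'"
    using R'(1) divide_left_mono[of 1 "(8 * K) ^ m" R'] by simp
  then have "pairwise (\<lambda>y z. 2 * (R / (8 * K) ^ Suc m) \<le> dist y z) (\<Union>y\<in>Y. Z y)"
    unfolding pow pairwise_def
  proof (intro ballI impI)
    fix u v
    assume small: "R' / (8 * K) ^ m \<le> R'"
      and "u \<in> (\<Union>y\<in>Y. Z y)" "v \<in> (\<Union>y\<in>Y. Z y)" "u \<noteq> v"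
    then obtain y z where yz: "y \<in> Y" "z \<in> Y" "u \<in> Z y" "v \<in> Z z" by blast
    show "2 * (R' / (8 * K) ^ m) \<le> dist u v"
    proof (cases "y = z")
      case True
      then show ?thesis using Z(3)[OF yz(1)] yz \<open>u \<noteq> v\<close> by (simp add: pairwise_def)
    next
      case False
      then show ?thesis using apart[OF yz(1,2) False yz(3,4)] small by linarith
    qed
  qed
  moreover have "(\<Union>y\<in>Y. Z y) \<subseteq> ball x R \<inter> F"
  proof
    fix u assume "u \<in> (\<Union>y\<in>Y. Z y)"
    then obtain y where y: "y \<in> Y" "u \<in> Z y" by blast
    then have "dist x y < R / 2" "dist y u < R'" "u \<in> F" using Y(2) Z(2)[OF y(1)] by auto
    then show "u \<in> ball x R \<inter> F"
      using dist_triangle[of x u y] R' by auto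
  qed
  moreover have "M ^ Suc m \<le> real (card (\<Union>y\<in>Y. Z y))"
  proof -
    have "\<forall>y\<in>Y. \<forall>z\<in>Y. y \<noteq> z \<longrightarrow> Z y \<inter> Z z = {}"
      using apart R'(1) by fastforce
    then have "card (\<Union>y\<in>Y. Z y) = (\<Sum>y\<in>Y. card (Z y))"
      using Y(1) Z(1) by (intro card_UN_disjoint) auto
    moreover have "M * M ^ m \<le> real (card Y) * M ^ m"
      using MY \<open>M \<ge> 0\<close> by (intro mult_right_mono) auto
    moreover have "real (card Y) * M ^ m \<le> (\<Sum>y\<in>Y. real (card (Z y)))"
      using sum_mono[of Y "\<lambda>_. M ^ m" "\<lambda>y. real (card (Z y))"] Z(4) by simp
    ultimately show ?thesis by simp
  qed
  moreover have "finite (\<Union>y\<in>Y. Z y)" using Y(1) Z(1) by blast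
  ultimately show ?case by blast
qed

definition lower_exponent :: "'a::metric_space set \<Rightarrow> real \<Rightarrow> bool" where
  "lower_exponent F s \<longleftrightarrow> (\<exists>C>0. \<forall>r R. 0 < r \<and> r < R \<and> R < 1 \<longrightarrow>
     (\<forall>x\<in>F. real (covering_number r (ball x R \<inter> F)) \<ge> C * (R / r) powr s))"

text \<open>
  Each step of the iteration multiplies the number of points by \<open>T powr s\<close> while the scale
  drops by \<open>T = 8 * K\<close>, so the count at depth \<open>m\<close> is the \<open>s\<close>-th power of the ratio of
  scales. The assumption speaks of radii below \<open>\<rho>\<close> only; larger balls are shrunk by the fixed
  factor \<open>\<sigma>\<close>, and rounding a ratio to a power of \<open>T\<close> costs at most another factor \<open>T\<close>. Both
  losses go into the constant.
\<close>
lemma lower_exponent_of_single_ratio: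
  fixes F :: "'a::euclidean_space set"
  assumes "bounded F" and "K \<ge> 1" and "s \<ge> 0" and "\<rho> > 0"
    and many: "\<And>R x. 0 < R \<Longrightarrow> R < \<rho> \<Longrightarrow> x \<in> F \<Longrightarrow>
      (8 * K) powr s \<le> real (covering_number (R / K) (ball x R \<inter> F))"
  shows "lower_exponent F s"
proof -
  define T where "T = 8 * K"
  have T: "T > 1" using \<open>K \<ge> 1\<close> by (simp add: T_def)
  define \<sigma> where "\<sigma> = min (\<rho> / 2) 1"
  have \<sigma>: "0 < \<sigma>" "\<sigma> \<le> 1" "\<sigma> < \<rho>" using \<open>\<rho> > 0\<close> by (auto simp: \<sigma>_def)
  have main: "(\<sigma> / T) powr s * (R / r) powr s \<le> real (covering_number r (ball x R \<inter> F))"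
    if r: "0 < r" "r < R" "R < 1" and x: "x \<in> F" for r R x
  proof -
    have bdd: "bounded (ball x R \<inter> F)" by (auto intro: bounded_Int)
    have eq: "(\<sigma> / T) powr s * (R / r) powr s = (\<sigma> * R / r / T) powr s"
      using r \<sigma> T by (simp add: powr_mult[symmetric] mult.commute)
    show ?thesis
    proof (cases "\<sigma> * R \<le> r")
      case True
      then have "\<sigma> * R / r \<le> 1" using r by simp
      then have "\<sigma> * R / r / T \<le> 1"
        using T by (subst divide_le_eq_1_pos) linarith+
      then have "(\<sigma> * R / r / T) powr s \<le> 1"
        using r \<sigma> T \<open>s \<ge> 0\<close> by (intro powr_le1) auto
      also have "1 \<le> real (covering_number r (ball x R \<inter> F))"
        using one_le_covering_number[OF bdd r(1), of x] r x by simp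
      finally show ?thesis using eq by simp
    next
      case False
      \<comment> \<open>the largest \<open>m\<close> for which \<open>\<sigma> * R / T ^ m\<close> is still at least \<open>r\<close>\<close>
      define m where "m = nat \<lfloor>log T (\<sigma> * R / r)\<rfloor>"
      have q: "1 < \<sigma> * R / r" using False r by simp
      have "0 \<le> log T (\<sigma> * R / r)" using q T by (simp add: zero_le_log_cancel_iff)
      then have "real m \<le> log T (\<sigma> * R / r)" "log T (\<sigma> * R / r) < real (Suc m)"
        unfolding m_def by linarith+
      then have m: "T powr real m \<le> \<sigma> * R / r" "\<sigma> * R / r < T powr real (Suc m)"
        using q T by (simp_all add: le_log_iff log_less_iff)
      then have m': "T ^ m \<le> \<sigma> * R / r" "\<sigma> * R / r < T ^ Suc m"
        using T by (simp_all add: powr_realpow del: of_nat_Suc power_Suc)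
      have "\<sigma> * R \<le> \<sigma> * 1" "\<sigma> * R \<le> 1 * R"
        using \<sigma> r by (intro mult_left_mono mult_right_mono; simp)+
      moreover have "0 < \<sigma> * R" using \<sigma> r by simp
      ultimately have "0 < \<sigma> * R" "\<sigma> * R < \<rho>" "\<sigma> * R \<le> R"
        using \<sigma> by linarith+
      then have "\<exists>Y. finite Y \<and> Y \<subseteq> ball x (\<sigma> * R) \<inter> F \<and>
          pairwise (\<lambda>y z. 2 * (\<sigma> * R / T ^ m) \<le> dist y z) Y \<and> (T powr s) ^ m \<le> real (card Y)"
        unfolding T_def using many x
        by (intro iterated_separated_set[OF assms(1,2), where \<rho> = \<rho>]) (simp_all only: powr_ge_zero)
      then obtain Y where Y: "finite Y" "Y \<subseteq> ball x (\<sigma> * R) \<inter> F"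
          "pairwise (\<lambda>y z. 2 * (\<sigma> * R / T ^ m) \<le> dist y z) Y" "(T powr s) ^ m \<le> real (card Y)"
        by blast
      have "r \<le> \<sigma> * R / T ^ m" using m'(1) r T by (simp add: field_simps)
      then have "pairwise (\<lambda>y z. 2 * r \<le> dist y z) Y"
        using Y(3) by (fastforce simp: pairwise_def)
      then have "card Y \<le> covering_number r (ball x R \<inter> F)"
        using Y \<open>\<sigma> * R \<le> R\<close> by (intro card_separated_le_covering_number[OF bdd r(1)]) auto
      moreover have "(\<sigma> * R / r / T) powr s \<le> (T ^ m) powr s"
        using m'(2) T q r \<sigma> \<open>s \<ge> 0\<close> by (intro powr_mono2) (auto simp: field_simps)
      moreover have "(T ^ m) powr s = (T powr s) ^ m"
        using T by (simp add: powr_powr powr_realpow[symmetric] mult.commute)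
      ultimately show ?thesis using eq Y(4) by linarith
    qed
  qed
  have "0 < (\<sigma> / T) powr s" using \<sigma> T by simp
  with main show ?thesis unfolding lower_exponent_def by blast
qed

section \<open>A dimension function with prescribed values along a sequence\<close>

text \<open>
  In the variable \<open>t = ln (1 / R)\<close>, dimension functions \<open>\<Psi>\<close> correspond to functions
  \<open>g t = \<Psi> R * t\<close> that are nondecreasing and unbounded and for which \<open>g t / t\<close> is
  nonincreasing. Both monotonicity properties pass to suprema. The smallest function that has them
  and the value \<open>k n\<close> at \<open>t n = ln (1 / \<rho> n)\<close> is \<open>k n * min 1 (t / t n)\<close>. The supremum of these
  over \<open>n\<close> lies below \<open>\<phi>\<close> because \<open>\<phi>\<close> has the same two properties and lies above the points.
  It takes the value \<open>k n\<close> at \<open>t n\<close> because earlier terms have at most the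
  height \<open>k n\<close> and later ones at most the slope \<open>k n / t n\<close>.
\<close>
lemma dimension_function_through_points:
  fixes \<phi> :: "real \<Rightarrow> real" and \<rho> k :: "nat \<Rightarrow> real"
  assumes "dimension_function \<phi>"
    and \<rho>: "\<And>n. 0 < \<rho> n" "\<And>n. \<rho> n < 1"
    and k: "\<And>n. 0 < k n" "mono k" "filterlim k at_top sequentially"
    and le: "\<And>n. k n \<le> \<phi> (\<rho> n) * ln (1 / \<rho> n)"
    and slope: "antimono (\<lambda>n. k n / ln (1 / \<rho> n))"
  obtains \<Psi> where "dimension_function \<Psi>" "\<And>R. 0 < R \<Longrightarrow> R < 1 \<Longrightarrow> \<Psi> R \<le> \<phi> R"
    "\<And>n. \<Psi> (\<rho> n) * ln (1 / \<rho> n) = k n"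
proof -
  have \<phi>: "mono_on {0<..<1} \<phi>" "monotone_on {0<..<1} (\<le>) (\<ge>) (\<lambda>R. \<phi> R * ln (1 / R))"
    using assms(1) by (auto simp: dimension_function_def)
  define t where "t R = ln (1 / R)" for R :: real
  have t_pos: "0 < t R" if "0 < R" "R < 1" for R
    using that by (simp add: t_def)
  have t_mono: "t R \<le> t S" if "0 < S" "S \<le> R" for R S
    using that by (simp add: t_def frac_le)
  define h where "h n R = min (k n / t R) (k n / t (\<rho> n))" for n R
  define \<Psi> where "\<Psi> R = (SUP n. h n R)" for R
  have h_pos: "0 < h n R" if "0 < R" "R < 1" for n R
    using that k(1) t_pos \<rho> by (simp add: h_def)
  have h_le: "h n R \<le> \<phi> R" if "0 < R" "R < 1" for n R
  proof (cases "R \<le> \<rho> n")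
    case True
    have "k n \<le> \<phi> (\<rho> n) * t (\<rho> n)" using le by (simp add: t_def)
    also have "\<dots> \<le> \<phi> R * t R"
      using monotone_onD[OF \<phi>(2), of R "\<rho> n"] True that \<rho>[of n] by (auto simp: t_def)
    finally have "k n / t R \<le> \<phi> R"
      using t_pos[OF that] by (simp add: field_simps)
    then show ?thesis by (simp add: h_def)
  next
    case False
    have "k n / t (\<rho> n) \<le> \<phi> (\<rho> n)"
      using le[of n] t_pos[OF \<rho>, of n] by (simp add: field_simps t_def)
    also have "\<dots> \<le> \<phi> R"
      using mono_onD[OF \<phi>(1), of "\<rho> n" R] False that \<rho>[of n] by auto
    finally show ?thesis by (simp add: h_def)
  qed
  have bdd: "bdd_above (range (\<lambda>n. h n R))" if "0 < R" "R < 1" for R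
    using h_le[OF that] by (auto intro!: bdd_aboveI)
  have h_le_\<Psi>: "h n R \<le> \<Psi> R" if "0 < R" "R < 1" for n R
    unfolding \<Psi>_def using bdd[OF that] by (intro cSUP_upper) auto
  have \<Psi>_least: "\<Psi> R \<le> c" if "\<And>n. h n R \<le> c" for R c
    unfolding \<Psi>_def using that by (intro cSUP_least) auto
  have h_mult: "h n R * t R = min (k n) (k n / t (\<rho> n) * t R)" if "0 < R" "R < 1" for n R
    using t_pos[OF that] by (simp add: h_def min_mult_distrib_right)
  have through: "\<Psi> (\<rho> n) * t (\<rho> n) = k n" for n
  proof -
    have "\<Psi> (\<rho> n) = k n / t (\<rho> n)"
    proof (rule antisym)
      show "\<Psi> (\<rho> n) \<le> k n / t (\<rho> n)"
      proof (rule \<Psi>_least)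
        fix m
        show "h m (\<rho> n) \<le> k n / t (\<rho> n)"
        proof (cases "m \<le> n")
          case True
          then have "k m / t (\<rho> n) \<le> k n / t (\<rho> n)"
            using t_pos[OF \<rho>, of n] monoD[OF k(2)] by (simp add: divide_right_mono)
          then show ?thesis by (simp add: h_def)
        next
          case False
          then have "k m / t (\<rho> m) \<le> k n / t (\<rho> n)"
            using antimonoD[OF slope, of n m] by (simp add: t_def)
          then show ?thesis by (simp add: h_def)
        qed
      qed
      show "k n / t (\<rho> n) \<le> \<Psi> (\<rho> n)"
        using h_le_\<Psi>[OF \<rho>, of n n] by (simp add: h_def)
    qed
    then show ?thesis using t_pos[OF \<rho>, of n] by simp
  qed
  have mono: "\<Psi> S \<le> \<Psi> R" if "0 < S" "S \<le> R" "R < 1" for R S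
  proof (rule \<Psi>_least)
    fix n
    have "k n / t S \<le> k n / t R"
      using that t_pos[of R] t_mono[of S R] k(1)[of n] by (intro divide_left_mono) auto
    then have "h n S \<le> h n R" by (auto simp: h_def)
    also have "\<dots> \<le> \<Psi> R" using that by (intro h_le_\<Psi>) auto
    finally show "h n S \<le> \<Psi> R" .
  qed
  have anti: "\<Psi> R * t R \<le> \<Psi> S * t S" if "0 < S" "S \<le> R" "R < 1" for R S
  proof -
    have "\<Psi> R \<le> \<Psi> S * t S / t R"
    proof (rule \<Psi>_least)
      fix n
      have "k n / t (\<rho> n) * t R \<le> k n / t (\<rho> n) * t S"
        using t_mono[OF that(1,2)] k(1)[of n] t_pos[OF \<rho>, of n] by (intro mult_left_mono) auto
      then have "h n R * t R \<le> h n S * t S"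
        using that h_mult[of R n] h_mult[of S n] by auto
      also have "\<dots> \<le> \<Psi> S * t S"
        using that t_pos[of S] h_le_\<Psi>[of S n] by (intro mult_right_mono) auto
      finally show "h n R \<le> \<Psi> S * t S / t R"
        using that t_pos[of R] by (simp add: field_simps)
    qed
    then show ?thesis using that t_pos[of R] by (simp add: field_simps)
  qed
  have "filterlim (\<lambda>R. \<Psi> R * t R) at_top (at_right 0)"
    unfolding filterlim_at_top
  proof
    fix Z :: real
    obtain n where n: "Z \<le> k n"
      using k(3) unfolding filterlim_at_top eventually_sequentially by blast
    have "\<forall>\<^sub>F R in at_right 0. R \<in> {0<..<\<rho> n}"
      using \<rho>(1) by (rule eventually_at_right_real)
    then show "\<forall>\<^sub>F R in at_right 0. Z \<le> \<Psi> R * t R"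
    proof eventually_elim
      case (elim R)
      then show ?case using anti[of R "\<rho> n"] through[of n] n \<rho>(2)[of n] by simp
    qed
  qed
  moreover have "0 < \<Psi> R" if "0 < R" "R < 1" for R
    using h_pos[OF that, of 0] h_le_\<Psi>[OF that, of 0] by linarith
  ultimately have "dimension_function \<Psi>"
    using mono anti unfolding dimension_function_def
    by (auto simp: mono_on_def monotone_on_def t_def)
  then show ?thesis
    using that[of \<Psi>] \<Psi>_least h_le through by (auto simp: t_def)
qed

section \<open>Comparison of the dimensions\<close>

lemma INF_covering_number_le:
  assumes "x \<in> F"
  shows "(INF x\<in>F. real (covering_number r (ball x R \<inter> F)))
    \<le> real (covering_number r (ball x R \<inter> F))"
  using assms by (intro cINF_lower) (auto intro!: bdd_belowI[of _ 0])

lemma lower_dim_le_quasi_phi_lower_dim: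
  fixes F :: "'a::metric_space set"
  assumes "F \<noteq> {}"
  shows "lower_dim F \<le> quasi_phi_lower_dim \<Psi> F"
  unfolding lower_dim_def quasi_phi_lower_dim_def
proof (rule Sup_subset_mono, rule image_mono, safe)
  fix s C :: real
  assume "C > 0" and C: "\<forall>r R. 0 < r \<and> r < R \<and> R < 1 \<longrightarrow>
     (\<forall>x\<in>F. real (covering_number r (ball x R \<inter> F)) \<ge> C * (R / r) powr s)"
  show "\<exists>C>0. \<forall>r R.
     0 < r \<and> r \<le> R powr (1 + \<Psi> R) \<and> R powr (1 + \<Psi> R) < R \<and> R < 1 \<longrightarrow>
     (INF x\<in>F. real (covering_number r (ball x R \<inter> F))) \<ge> C * (R / r) powr s"
    using \<open>C > 0\<close> C assms by (intro exI[of _ C]) (auto intro!: cINF_greatest)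
qed

lemma quasi_phi_lower_dim_le_phi_lower_dim:
  fixes F :: "'a::metric_space set"
  assumes "dimension_function \<Psi>"
  shows "quasi_phi_lower_dim \<Psi> F \<le> phi_lower_dim \<Psi> F"
  unfolding phi_lower_dim_def quasi_phi_lower_dim_def
proof (rule Sup_subset_mono, rule image_mono, safe)
  fix s C :: real
  assume "C > 0" and C: "\<forall>r R.
     0 < r \<and> r \<le> R powr (1 + \<Psi> R) \<and> R powr (1 + \<Psi> R) < R \<and> R < 1 \<longrightarrow>
     (INF x\<in>F. real (covering_number r (ball x R \<inter> F))) \<ge> C * (R / r) powr s"
  have "C * R powr (- \<Psi> R * s) \<le>
      (INF x\<in>F. real (covering_number (R powr (1 + \<Psi> R)) (ball x R \<inter> F)))"
    if R: "0 < R" "R < 1" for R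
  proof -
    have "0 < \<Psi> R" using assms R by (simp add: dimension_function_def)
    then have "R powr (1 + \<Psi> R) < R powr 1" using R by (intro powr_less_mono') auto
    moreover have "R / R powr (1 + \<Psi> R) = R powr (- \<Psi> R)"
      using R by (simp add: powr_add powr_minus field_simps)
    then have "(R / R powr (1 + \<Psi> R)) powr s = R powr (- \<Psi> R * s)"
      by (simp only: powr_powr)
    ultimately show ?thesis
      using C[rule_format, of "R powr (1 + \<Psi> R)" R] R by simp
  qed
  then show "\<exists>C>0. \<forall>R. 0 < R \<and> R < 1 \<longrightarrow>
     (INF x\<in>F. real (covering_number (R powr (1 + \<Psi> R)) (ball x R \<inter> F)))
       \<ge> C * R powr (- \<Psi> R * s)"
    using \<open>C > 0\<close> by blast
qed

lemma lower_dim_nonneg: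
  fixes F :: "'a::euclidean_space set"
  assumes "bounded F"
  shows "0 \<le> lower_dim F"
proof -
  have "1 * (R / r) powr 0 \<le> real (covering_number r (ball x R \<inter> F))"
    if "0 < r" "r < R" "R < 1" "x \<in> F" for r R x
    using one_le_covering_number[of "ball x R \<inter> F" r x] that by (auto intro: bounded_Int)
  then have "ereal 0 \<le> lower_dim F"
    unfolding lower_dim_def by (intro Sup_upper imageI) (auto intro!: exI[of _ 1])
  then show ?thesis by (simp add: zero_ereal_def)
qed

text \<open>
  The contrapositive of \<open>lower_exponent_of_single_ratio\<close>. The freedom to prescribe \<open>K\<close> and at
  the same time make \<open>R\<close> small is what allows \<open>\<Psi>\<close> to lie below an arbitrary \<open>\<phi>\<close>.
\<close>
lemma thin_ball_at_given_ratio: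
  fixes F :: "'a::euclidean_space set"
  assumes "bounded F" and "lower_dim F < ereal s" and "K \<ge> 1" and "\<rho> > 0"
  obtains R x where "0 < R" "R < \<rho>" "x \<in> F"
    "real (covering_number (R / K) (ball x R \<inter> F)) < (8 * K) powr s"
proof -
  have "0 < ereal s"
    using lower_dim_nonneg[OF assms(1)] assms(2) by (rule le_less_trans)
  then have s: "0 \<le> s" by simp
  have "\<not> lower_exponent F s"
  proof
    assume "lower_exponent F s"
    then have "ereal s \<le> lower_dim F"
      unfolding lower_dim_def lower_exponent_def using s by (intro Sup_upper) auto
    then show False using assms(2) by simp
  qed
  then show ?thesis
    using lower_exponent_of_single_ratio[OF assms(1,3) s assms(4)] that
    by (meson not_less)
qed

theorem theorem4:
  fixes F :: "(real ^ 'n) set" and \<phi> :: "real \<Rightarrow> real"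
  assumes "F \<noteq> {}" and "bounded F" and "dimension_function \<phi>"
  shows "\<exists>\<Psi>. dimension_function \<Psi> \<and>
           (\<forall>\<^sub>F R in at_right 0. \<Psi> R \<le> \<phi> R) \<and>
           phi_lower_dim \<Psi> F = quasi_phi_lower_dim \<Psi> F \<and>
           quasi_phi_lower_dim \<Psi> F = lower_dim F"
proof -
  have "\<exists>\<Psi>. dimension_function \<Psi> \<and> (\<forall>\<^sub>F R in at_right 0. \<Psi> R \<le> \<phi> R) \<and>
      phi_lower_dim \<Psi> F \<le> lower_dim F"
  proof (cases "lower_dim F = \<infinity>")
    case True
    then show ?thesis using assms(3) by (intro exI[of _ \<phi>]) auto
  next
    case False
    with lower_dim_nonneg[OF assms(2)] obtain L where L: "lower_dim F = ereal L" "0 \<le> L"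
      by (cases "lower_dim F") auto
    define k where "k n = real (Suc n)" for n
    define s where "s n = L + 1 / k n" for n
    define thin where "thin n R \<longleftrightarrow> (\<exists>x\<in>F.
      real (covering_number (R / exp (k n)) (ball x R \<inter> F)) < (8 * exp (k n)) powr s n)" for n R
    have k: "0 < k n" "1 \<le> k n" for n by (simp_all add: k_def)
    \<comment> \<open>The bound by \<open>c\<close> makes the slopes \<open>k n / ln (1 / \<rho> n)\<close> decrease along the sequence.\<close>
    have next_scale: "\<exists>R. (0 < R \<and> R < 1 \<and> k n \<le> \<phi> R * ln (1 / R) \<and> thin n R) \<and>
        k n / ln (1 / R) \<le> c"
      if "c > 0" for n c
    proof -
      have lim: "filterlim (\<lambda>R::real. ln (1 / R)) at_top (at_right 0)" by real_asymp
      have "\<forall>\<^sub>F R in at_right 0. k n \<le> \<phi> R * ln (1 / R)"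
        using assms(3) by (simp add: dimension_function_def filterlim_at_top)
      moreover have "\<forall>\<^sub>F R in at_right 0. k n / c \<le> ln (1 / R)"
        using lim by (simp add: filterlim_at_top)
      moreover have "\<forall>\<^sub>F R in at_right 0. R \<in> {0<..<1::real}"
        by (rule eventually_at_right_real) simp
      ultimately have "\<forall>\<^sub>F R in at_right 0. 0 < R \<and> R < 1 \<and> k n \<le> \<phi> R * ln (1 / R) \<and>
          k n / ln (1 / R) \<le> c"
      proof eventually_elim
        case (elim R)
        then have "0 < ln (1 / R)" by simp
        then show ?case using elim \<open>c > 0\<close> by (simp add: field_simps)
      qed
      then obtain \<rho> where \<rho>: "\<rho> > 0" "\<And>R. 0 < R \<Longrightarrow> R < \<rho> \<Longrightarrow>
          0 < R \<and> R < 1 \<and> k n \<le> \<phi> R * ln (1 / R) \<and> k n / ln (1 / R) \<le> c"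
        unfolding eventually_at_right_field by blast
      have "lower_dim F < ereal (s n)" "1 \<le> exp (k n)"
        using k[of n] by (simp_all add: L s_def)
      then obtain R where "0 < R" "R < \<rho>" "thin n R"
        using thin_ball_at_given_ratio[OF assms(2) _ _ \<rho>(1)] unfolding thin_def by metis
      then show ?thesis using \<rho>(2) by blast
    qed
    obtain \<rho> where \<rho>: "\<And>n. 0 < \<rho> n \<and> \<rho> n < 1 \<and> k n \<le> \<phi> (\<rho> n) * ln (1 / \<rho> n) \<and> thin n (\<rho> n)"
      "\<And>n. k (Suc n) / ln (1 / \<rho> (Suc n)) \<le> k n / ln (1 / \<rho> n)"
    proof (rule dependent_nat_choice[of
        "\<lambda>n R. 0 < R \<and> R < 1 \<and> k n \<le> \<phi> R * ln (1 / R) \<and> thin n R"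
        "\<lambda>n R S. k (Suc n) / ln (1 / S) \<le> k n / ln (1 / R)", THEN exE])
      show "\<exists>R. 0 < R \<and> R < 1 \<and> k 0 \<le> \<phi> R * ln (1 / R) \<and> thin 0 R"
        using next_scale[of 1 0] by auto
      show "\<exists>S. (0 < S \<and> S < 1 \<and> k (Suc n) \<le> \<phi> S * ln (1 / S) \<and> thin (Suc n) S) \<and>
          k (Suc n) / ln (1 / S) \<le> k n / ln (1 / R)"
        if "0 < R \<and> R < 1 \<and> k n \<le> \<phi> R * ln (1 / R) \<and> thin n R" for R n
        using that k(1)[of n] by (intro next_scale) simp
    qed blast
    have "mono k" by (auto simp: k_def mono_def)
    moreover have "filterlim k at_top sequentially" unfolding k_def by real_asymp
    moreover have "antimono (\<lambda>n. k n / ln (1 / \<rho> n))"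
      using \<rho>(2) by (intro decseq_SucI)
    ultimately obtain \<Psi> where \<Psi>: "dimension_function \<Psi>"
        "\<And>R. 0 < R \<Longrightarrow> R < 1 \<Longrightarrow> \<Psi> R \<le> \<phi> R" "\<And>n. \<Psi> (\<rho> n) * ln (1 / \<rho> n) = k n"
      using dimension_function_through_points[OF assms(3), of \<rho> k] \<rho>(1) k(1) by metis
    have "phi_lower_dim \<Psi> F \<le> lower_dim F"
      unfolding phi_lower_dim_def
    proof (rule Sup_least, safe)
      fix u C :: real
      assume "C > 0" and C: "\<forall>R. 0 < R \<and> R < 1 \<longrightarrow>
        (INF x\<in>F. real (covering_number (R powr (1 + \<Psi> R)) (ball x R \<inter> F)))
          \<ge> C * R powr (- \<Psi> R * u)"
      \<comment> \<open>The exponents \<open>s n = L + 1 / k n\<close> tend to \<open>L\<close> at such a rate that replacing \<open>s n\<close> by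
        \<open>L\<close> in \<open>exp (k n * s n)\<close> costs only the factor \<open>exp 1\<close>.\<close>
      have bound: "C * exp (k n * (u - L)) \<le> 8 powr (L + 1) * exp 1" for n
      proof -
        have R: "0 < \<rho> n" "\<rho> n < 1" using \<rho>(1) by auto
        have "\<Psi> (\<rho> n) * ln (\<rho> n) = - k n" using \<Psi>(3)[of n] R by (simp add: ln_div)
        then have e: "\<rho> n powr \<Psi> (\<rho> n) = exp (- k n)" using R by (simp add: powr_def)
        have r: "\<rho> n powr (1 + \<Psi> (\<rho> n)) = \<rho> n / exp (k n)"
          using R e by (simp add: powr_add exp_minus field_simps)
        have "\<rho> n powr (- \<Psi> (\<rho> n) * u) = (\<rho> n powr \<Psi> (\<rho> n)) powr (- u)"
          by (simp add: powr_powr)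
        also have "\<dots> = exp (k n * u)" unfolding e by (simp add: powr_def mult.commute)
        finally have l: "\<rho> n powr (- \<Psi> (\<rho> n) * u) = exp (k n * u)" .
        obtain x where x: "x \<in> F" "real (covering_number (\<rho> n / exp (k n)) (ball x (\<rho> n) \<inter> F))
            < (8 * exp (k n)) powr s n"
          using \<rho>(1)[of n] unfolding thin_def by blast
        have "C * exp (k n * u) \<le> (8 * exp (k n)) powr s n"
          using C[rule_format, of "\<rho> n"] R INF_covering_number_le[OF x(1), of "\<rho> n / exp (k n)" "\<rho> n"] x(2)
          unfolding r l by linarith
        also have "\<dots> = 8 powr s n * exp (k n * s n)"
          by (simp add: powr_mult powr_def[of "exp (k n)"] mult.commute)
        also have "k n * s n = k n * L + 1"
          using k(1)[of n] by (simp add: s_def field_simps)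
        also have "8 powr s n \<le> 8 powr (L + 1)"
          using k(2)[of n] by (intro powr_mono) (auto simp: s_def)
        finally have "C * exp (k n * u) \<le> 8 powr (L + 1) * exp (k n * L + 1)"
          by (simp add: mult_right_mono)
        then show ?thesis
          by (simp add: exp_add exp_diff right_diff_distrib field_simps)
      qed
      have "u \<le> L"
      proof (rule ccontr)
        assume "\<not> u \<le> L"
        then have "filterlim (\<lambda>n. C * exp (k n * (u - L))) at_top sequentially"
          using \<open>C > 0\<close> unfolding k_def by real_asymp
        then obtain n where "8 powr (L + 1) * exp 1 < C * exp (k n * (u - L))"
          unfolding filterlim_at_top_dense eventually_sequentially by blast
        then show False using bound[of n] by simp
      qed
      then show "ereal u \<le> lower_dim F" by (simp add: L)
    qed
    moreover have "\<forall>\<^sub>F R in at_right 0. \<Psi> R \<le> \<phi> R"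
      using eventually_at_right_real[OF zero_less_one] by eventually_elim (auto intro: \<Psi>(2))
    ultimately show ?thesis using \<Psi>(1) by blast
  qed
  then show ?thesis
    using lower_dim_le_quasi_phi_lower_dim[OF assms(1)] quasi_phi_lower_dim_le_phi_lower_dim
    by (metis order_antisym order_trans)
qed

end
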